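(* Let $m,n\ge 1$ be integers, and let $A^0,A^1,\dots,A^n,L$ be real constant $m\times m$ matrices satisfying condition (A) (see context). If the rank condition (R) (see context) holds, then condition (K) (see context) holds; that is, (R) is a sufficient condition for (K).
   Context: Notation. $\langle\cdot,\cdot\rangle$ is the standard complex inner product on $\mathbb{C}^m$. For a matrix $X$ and a subspace $V\subset\mathbb{C}^m$, "$X\ge 0$ on $V$" means $\mathrm{Re}\,\langle Xz,z\rangle\ge 0$ for all $z\in V$, and "$X>0$ on $V$" means $\mathrm{Re}\,\langle Xz,z\rangle>0$ for all $0\ne z\in V$. For a real square matrix $X$, $X_1:=(X+X^T)/2$ is its symmetric part. Kernels are taken in $\mathbb{C}^m$. For $\omega\in S^{n-1}$, $A(\omega):=\sum_{j=1}^nA^j\omega_j$. Condition (A): $A^0,A^1,\dots,A^n$ are real symmetric, $A^0>0$ on $\mathbb{C}^m$, $L$ is real (not necessarily symmetric) with $L\ge 0$ on $\mathbb{C}^m$, and $\mathrm{Ker}(L)\ne\{0\}$. Condition (R): with $\tilde A(\omega):=(A^0)^{-1}A(\omega)$, for each $\omega\in S^{n-1}$ the $m^2\times m$ matrix $$\begin{bmatrix}L\\ L\tilde A(\omega)\\ \vdots\\ L\tilde A(\omega)^{m-1}\end{bmatrix}$$ has rank $m$. Condition (K): there is a real matrix-valued function $K(\omega)\in C^\infty(S^{n-1})$ such that for each $\omega\in S^{n-1}$: $K(-\omega)=-K(\omega)$, $(K(\omega)A^0)^T=-K(\omega)A^0$, and $(K(\omega)A(\omega))_1>0$ on $\mathrm{Ker}(L)$.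 *)

theory Defs
  imports "HOL-Analysis.Analysis"
begin

text \<open>The dimensions \<open>m\<close> and \<open>n\<close> are the cardinalities of the finite index types
  \<open>'m\<close> and \<open>'n\<close>.\<close>

definition cinner :: "complex ^ 'm \<Rightarrow> complex ^ 'm \<Rightarrow> complex" where
  "cinner z w = (\<Sum>i\<in>UNIV. z $ i * cnj (w $ i))"

definition complexify :: "real ^ 'm ^ 'k \<Rightarrow> complex ^ 'm ^ 'k" where
  "complexify X = map_matrix complex_of_real X"

definition Ker :: "complex ^ 'm ^ 'k \<Rightarrow> (complex ^ 'm) set" where
  "Ker X = {z. X *v z = 0}"

definition nonneg_on :: "complex ^ 'm ^ 'm \<Rightarrow> (complex ^ 'm) set \<Rightarrow> bool" where
  "nonneg_on X V \<longleftrightarrow> (\<forall>z\<in>V. Re (cinner (X *v z) z) \<ge> 0)"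

definition pos_on :: "complex ^ 'm ^ 'm \<Rightarrow> (complex ^ 'm) set \<Rightarrow> bool" where
  "pos_on X V \<longleftrightarrow> (\<forall>z\<in>V. z \<noteq> 0 \<longrightarrow> Re (cinner (X *v z) z) > 0)"

definition sym_part :: "real ^ 'm ^ 'm \<Rightarrow> real ^ 'm ^ 'm" where
  "sym_part X = (1 / 2) *\<^sub>R (X + transpose X)"

text \<open>Powers with respect to \<open>**\<close>; the overloaded \<open>^\<close> on vectors would be taken componentwise.\<close>

primrec matrix_power :: "real ^ 'm ^ 'm \<Rightarrow> nat \<Rightarrow> real ^ 'm ^ 'm" where
  "matrix_power X 0 = mat 1"
| "matrix_power X (Suc k) = X ** matrix_power X k"

definition symbol :: "('n::finite \<Rightarrow> real ^ 'm ^ 'm) \<Rightarrow> real ^ 'n \<Rightarrow> real ^ 'm ^ 'm" where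
  "symbol A \<omega> = (\<Sum>j\<in>UNIV. (\<omega> $ j) *\<^sub>R A j)"

text \<open>\<open>higher_differentiable_on S f k\<close> is meant for open \<open>S\<close>: all iterated directional
  derivatives of \<open>f\<close> up to order \<open>k\<close> exist and are continuous on \<open>S\<close>.\<close>

primrec higher_differentiable_on ::
  "'a::real_normed_vector set \<Rightarrow> ('a \<Rightarrow> 'b::real_normed_vector) \<Rightarrow> nat \<Rightarrow> bool" where
  "higher_differentiable_on S f 0 \<longleftrightarrow> continuous_on S f"
| "higher_differentiable_on S f (Suc k) \<longleftrightarrow>
     (\<forall>x\<in>S. f differentiable (at x)) \<and>
     (\<forall>v. higher_differentiable_on S (\<lambda>x. frechet_derivative f (at x) v) k)"

text \<open>Smoothness on the embedded submanifold \<open>sphere 0 1\<close>: \<open>f\<close> is the restriction of a function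
  that is smooth on an open neighbourhood of the sphere. Values of \<open>f\<close> off the sphere are
  irrelevant.\<close>

definition smooth_on_unit_sphere ::
  "('a::real_normed_vector \<Rightarrow> 'b::real_normed_vector) \<Rightarrow> bool" where
  "smooth_on_unit_sphere f \<longleftrightarrow>
     (\<exists>U F. open U \<and> sphere 0 1 \<subseteq> U \<and> (\<forall>k. higher_differentiable_on U F k) \<and>
            (\<forall>\<omega>\<in>sphere 0 1. F \<omega> = f \<omega>))"

definition condition_A ::
  "real ^ 'm ^ 'm \<Rightarrow> ('n::finite \<Rightarrow> real ^ 'm ^ 'm) \<Rightarrow> real ^ 'm ^ 'm \<Rightarrow> bool" where
  "condition_A A0 A L \<longleftrightarrow>
     transpose A0 = A0 \<and> (\<forall>j. transpose (A j) = A j) \<and>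
     pos_on (complexify A0) UNIV \<and>
     nonneg_on (complexify L) UNIV \<and>
     Ker (complexify L) \<noteq> {0}"

text \<open>The \<open>m\<^sup>2 \<times> m\<close> matrix with blocks \<open>L, L X, \<dots>, L X\<^bsup>m-1\<^esup>\<close>. A row is indexed by a pair
  \<open>(b, i)\<close>: block \<open>b\<close>, row \<open>i\<close> within that block. Since \<open>'m\<close> is finite,
  \<open>to_nat_on UNIV\<close> is a bijection from \<open>'m\<close> onto \<open>{..<m}\<close>, so each exponent \<open>0, \<dots>, m-1\<close>
  belongs to exactly one block; the order of the blocks does not affect the rank.\<close>

definition stacked_matrix ::
  "real ^ 'm ^ 'm \<Rightarrow> real ^ 'm ^ 'm \<Rightarrow> real ^ 'm ^ ('m \<times> 'm)" where
  "stacked_matrix L X =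
     (\<chi> p. (L ** matrix_power X (to_nat_on (UNIV :: 'm set) (fst p))) $ snd p)"

definition condition_R ::
  "real ^ 'm ^ 'm \<Rightarrow> ('n::finite \<Rightarrow> real ^ 'm ^ 'm) \<Rightarrow> real ^ 'm ^ 'm \<Rightarrow> bool" where
  "condition_R A0 A L \<longleftrightarrow>
     (\<forall>\<omega>\<in>sphere 0 1. rank (stacked_matrix L (matrix_inv A0 ** symbol A \<omega>)) = CARD('m))"

definition condition_K ::
  "real ^ 'm ^ 'm \<Rightarrow> ('n::finite \<Rightarrow> real ^ 'm ^ 'm) \<Rightarrow> real ^ 'm ^ 'm \<Rightarrow> bool" where
  "condition_K A0 A L \<longleftrightarrow>
     (\<exists>K :: real ^ 'n \<Rightarrow> real ^ 'm ^ 'm.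
        smooth_on_unit_sphere K \<and>
        (\<forall>\<omega>\<in>sphere 0 1.
           K (- \<omega>) = - K \<omega> \<and>
           transpose (K \<omega> ** A0) = - (K \<omega> ** A0) \<and>
           pos_on (complexify (sym_part (K \<omega> ** symbol A \<omega>))) (Ker (complexify L))))"

end

theory Submission
  imports Defs
begin

text \<open>Put \<open>B = A0\<^sup>-\<^sup>1 A(\<omega>)\<close> and \<open>P\<^sub>j = L B\<^sup>j\<close>. The skew matrix
  \<open>S = \<Sum>\<^sub>j \<epsilon>\<^sub>j\<^sub>+\<^sub>1 (P\<^sub>j\<^sub>+\<^sub>1\<^sup>T P\<^sub>j - P\<^sub>j\<^sup>T P\<^sub>j\<^sub>+\<^sub>1)\<close> is an odd polynomial in \<open>\<omega>\<close>, and
  \<open>\<langle>S B x, x\<rangle> = \<Sum>\<^sub>j \<epsilon>\<^sub>j\<^sub>+\<^sub>1 (|P\<^sub>j\<^sub>+\<^sub>1 x|\<^sup>2 - \<langle>P\<^sub>j\<^sub>+\<^sub>2 x, P\<^sub>j x\<rangle>)\<close>. If \<open>L x = 0\<close> and the weights are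
  sufficiently log-convex and decreasing, the cross terms are absorbed by the squares; the one
  reaching beyond the last square is controlled, uniformly in \<open>\<omega>\<close>, by the rank condition and
  compactness of the sphere. Hence \<open>K = S A0\<^sup>-\<^sup>1\<close> is a compensating matrix.\<close>

subsection \<open>Smooth maps\<close>

lemma higher_differentiable_on_Suc_imp:
  "higher_differentiable_on S f (Suc k) \<Longrightarrow> higher_differentiable_on S f k"
proof (induction k arbitrary: f)
  case 0
  then show ?case
    by (auto intro!: continuous_at_imp_continuous_on differentiable_imp_continuous_within)
next
  case (Suc k)
  then show ?case by (metis higher_differentiable_on.simps(2))
qed

text \<open>Derivatives are unique, so the recursive clause, stated for
  \<open>frechet_derivative\<close>, can be checked on any known derivative.\<close>

lemma higher_differentiable_on_UNIV_derivI:
  assumes "\<And>x. (f has_derivative f' x) (at x)"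
    and "\<And>v. higher_differentiable_on UNIV (\<lambda>x. f' x v) k"
  shows "higher_differentiable_on UNIV f (Suc k)"
proof -
  have "frechet_derivative f (at x) = f' x" for x
    using frechet_derivative_at[OF assms(1)] by simp
  then show ?thesis
    using assms by (auto simp: differentiable_def)
qed

lemma higher_differentiable_on_UNIV_has_derivative:
  assumes "higher_differentiable_on UNIV f (Suc k)"
  shows "(f has_derivative frechet_derivative f (at x)) (at x)"
  using assms by (simp add: frechet_derivative_works)

lemma higher_differentiable_on_const: "higher_differentiable_on UNIV (\<lambda>x. c) k"
proof (induction k arbitrary: c)
  case (Suc k)
  then show ?case
    by (intro higher_differentiable_on_UNIV_derivI[where f' = "\<lambda>x v. 0"]) auto
qed simp

lemma higher_differentiable_on_bounded_linear:
  assumes "bounded_linear f"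
  shows "higher_differentiable_on UNIV f k"
proof (cases k)
  case 0
  then show ?thesis
    using assms by (simp add: linear_continuous_on)
next
  case (Suc l)
  then show ?thesis
    using higher_differentiable_on_UNIV_derivI[of f "\<lambda>x. f"]
      bounded_linear_imp_has_derivative[OF assms] higher_differentiable_on_const by blast
qed

lemma higher_differentiable_on_add:
  assumes "higher_differentiable_on UNIV f k" "higher_differentiable_on UNIV g k"
  shows "higher_differentiable_on UNIV (\<lambda>x. f x + g x) k"
  using assms
proof (induction k arbitrary: f g)
  case 0
  then show ?case by (auto intro: continuous_on_add)
next
  case (Suc k)
  note d = Suc.prems[THEN higher_differentiable_on_UNIV_has_derivative]
  show ?case
    by (rule higher_differentiable_on_UNIV_derivI[OF has_derivative_add[OF d]])
      (use Suc in auto)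
qed

lemma higher_differentiable_on_sum:
  assumes "\<And>i. i \<in> I \<Longrightarrow> higher_differentiable_on UNIV (f i) k"
  shows "higher_differentiable_on UNIV (\<lambda>x. \<Sum>i\<in>I. f i x) k"
  using assms
  by (induction I rule: infinite_finite_induct)
    (auto intro: higher_differentiable_on_add higher_differentiable_on_const)

text \<open>The Leibniz rule gives a sum of two products of the same kind; the undifferentiated
  factor in each is lowered to order k by \<open>higher_differentiable_on_Suc_imp\<close>.\<close>

lemma higher_differentiable_on_bounded_bilinear:
  assumes "bounded_bilinear h"
    and "higher_differentiable_on UNIV f k" "higher_differentiable_on UNIV g k"
  shows "higher_differentiable_on UNIV (\<lambda>x. h (f x) (g x)) k"
  using assms(2,3)
proof (induction k arbitrary: f g)
  case 0
  then show ?case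
    by (simp add: bounded_bilinear.continuous_on[OF assms(1)])
next
  case (Suc k)
  note d = Suc.prems[THEN higher_differentiable_on_UNIV_has_derivative]
  show ?case
    by (rule higher_differentiable_on_UNIV_derivI
          [OF bounded_bilinear.FDERIV[OF assms(1) d]])
      (intro higher_differentiable_on_add Suc.IH;
        use Suc.prems in \<open>auto intro: higher_differentiable_on_Suc_imp\<close>)
qed

lemma higher_differentiable_on_linear_compose:
  assumes "bounded_linear h" "higher_differentiable_on UNIV f k"
  shows "higher_differentiable_on UNIV (\<lambda>x. h (f x)) k"
  using assms(2)
proof (induction k arbitrary: f)
  case 0
  then show ?case
    by (simp add: bounded_linear.continuous_on[OF assms(1)])
next
  case (Suc k)
  note d = Suc.prems[THEN higher_differentiable_on_UNIV_has_derivative]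
  show ?case
    by (rule higher_differentiable_on_UNIV_derivI
          [OF bounded_linear.has_derivative[OF assms(1) d]])
      (use Suc in auto)
qed

subsection \<open>Real matrices\<close>

lemma bounded_bilinear_matrix_mult:
  "bounded_bilinear ((**) :: real ^ 'b ^ 'a \<Rightarrow> real ^ 'c ^ 'b \<Rightarrow> real ^ 'c ^ 'a)"
  unfolding bilinear_conv_bounded_bilinear[symmetric] bilinear_def
  by (auto intro!: linearI
      simp: vec_eq_iff matrix_matrix_mult_def
        sum_distrib_left algebra_simps sum.distrib)

lemma bounded_bilinear_matrix_vector_mult:
  "bounded_bilinear ((*v) :: real ^ 'b ^ 'a \<Rightarrow> real ^ 'b \<Rightarrow> real ^ 'a)"
  unfolding bilinear_conv_bounded_bilinear[symmetric] bilinear_def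
  by (auto intro!: linearI
      simp: vec_eq_iff matrix_vector_mult_def sum_distrib_left algebra_simps sum.distrib)

lemma bounded_linear_transpose:
  "bounded_linear (transpose :: real ^ 'b ^ 'a \<Rightarrow> real ^ 'a ^ 'b)"
  unfolding linear_conv_bounded_linear[symmetric]
  by (auto intro!: linearI simp: vec_eq_iff transpose_def)

interpretation mm: bounded_bilinear "(**) :: real ^ 'b ^ 'a \<Rightarrow> real ^ 'c ^ 'b \<Rightarrow> real ^ 'c ^ 'a"
  by (rule bounded_bilinear_matrix_mult)

interpretation mv: bounded_bilinear "(*v) :: real ^ 'b ^ 'a \<Rightarrow> real ^ 'b \<Rightarrow> real ^ 'a"
  by (rule bounded_bilinear_matrix_vector_mult)

lemmas transpose_linear =
  linear_sum[OF bounded_linear.linear[OF bounded_linear_transpose]]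
  linear_diff[OF bounded_linear.linear[OF bounded_linear_transpose]]
  linear_neg[OF bounded_linear.linear[OF bounded_linear_transpose]]
  linear_cmul[OF bounded_linear.linear[OF bounded_linear_transpose]]

lemma higher_differentiable_on_matrix_mult:
  fixes F :: "'x::real_normed_vector \<Rightarrow> real ^ 'b ^ 'a" and G :: "'x \<Rightarrow> real ^ 'c ^ 'b"
  assumes "higher_differentiable_on UNIV F k" "higher_differentiable_on UNIV G k"
  shows "higher_differentiable_on UNIV (\<lambda>x. F x ** G x) k"
  using higher_differentiable_on_bounded_bilinear[OF bounded_bilinear_matrix_mult assms] .

lemma higher_differentiable_on_matrix_power:
  fixes F :: "'x::real_normed_vector \<Rightarrow> real ^ 'a ^ 'a"
  assumes "higher_differentiable_on UNIV F k"
  shows "higher_differentiable_on UNIV (\<lambda>x. matrix_power (F x) j) k"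
  by (induction j)
    (auto intro: higher_differentiable_on_matrix_mult higher_differentiable_on_const assms)

lemma higher_differentiable_on_symbol: "higher_differentiable_on UNIV (symbol A) k"
proof -
  have "linear (symbol A)"
    by (auto intro!: linearI
        simp: symbol_def scaleR_add_left sum.distrib scaleR_sum_right)
  then show ?thesis
    by (simp add: higher_differentiable_on_bounded_linear linear_conv_bounded_linear)
qed

lemma symbol_minus: "symbol A (- \<omega>) = - symbol A \<omega>"
  by (simp add: symbol_def sum_negf)

lemma matrix_power_minus: "matrix_power (- X) j = (- 1) ^ j *\<^sub>R matrix_power X j"
  by (induction j) (auto simp: mm.minus_left mm.scaleR_right)

text \<open>\<open>matrix_power\<close> multiplies on the left, while passing from
  \<open>P j\<close> to \<open>P (Suc j)\<close> in the main proof multiplies on the right.\<close>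

lemma matrix_power_commute: "matrix_power X j ** X = X ** matrix_power X j"
  by (induction j) (auto simp: matrix_mul_assoc[symmetric])

lemma inner_transpose_mult:
  fixes P Q :: "real ^ 'b ^ 'a"
  shows "((transpose P ** Q) *v x) \<bullet> y = (Q *v x) \<bullet> (P *v y)"
  by (simp add: matrix_vector_mul_assoc[symmetric] dot_lmul_matrix)

lemma inner_sym_part: "(sym_part X *v x) \<bullet> x = (X *v x) \<bullet> x"
proof -
  have "(transpose X *v x) \<bullet> x = (X *v x) \<bullet> x"
    using dot_lmul_matrix[of x X x] by (simp add: inner_commute)
  then show ?thesis
    by (simp add: sym_part_def mv.scaleR_left mv.add_left inner_add_left)
qed

subsection \<open>Complexified matrices\<close>

abbreviation re_vec :: "complex ^ 'm \<Rightarrow> real ^ 'm" where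
  "re_vec z \<equiv> (\<chi> i. Re (z $ i))"

abbreviation im_vec :: "complex ^ 'm \<Rightarrow> real ^ 'm" where
  "im_vec z \<equiv> (\<chi> i. Im (z $ i))"

text \<open>For real X the mixed terms between real and imaginary parts of z are purely imaginary.
  Complex positivity thus reduces to real quadratic forms.\<close>

lemma Re_cinner_complexify:
  fixes X :: "real ^ 'm ^ 'm"
  shows "Re (cinner (complexify X *v z) z)
    = (X *v re_vec z) \<bullet> re_vec z + (X *v im_vec z) \<bullet> im_vec z"
  by (simp add: cinner_def complexify_def map_matrix_def matrix_vector_mult_def inner_vec_def
      sum.distrib)

lemma Ker_complexifyD:
  assumes "z \<in> Ker (complexify X)"
  shows "X *v re_vec z = 0" "X *v im_vec z = 0"
proof -
  have "(\<Sum>j\<in>UNIV. complex_of_real (X $ i $ j) * z $ j) = 0" for i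
    using assms by (simp add: Ker_def complexify_def map_matrix_def matrix_vector_mult_def
        vec_eq_iff)
  from arg_cong[OF this, of Re] arg_cong[OF this, of Im]
  show "X *v re_vec z = 0" "X *v im_vec z = 0"
    by (simp_all add: matrix_vector_mult_def vec_eq_iff)
qed

lemma pos_on_complexify_KerI:
  fixes X :: "real ^ 'm ^ 'm" and L :: "real ^ 'm ^ 'k"
  assumes "\<And>x. L *v x = 0 \<Longrightarrow> x \<noteq> 0 \<Longrightarrow> (X *v x) \<bullet> x > 0"
  shows "pos_on (complexify X) (Ker (complexify L))"
  unfolding pos_on_def
proof (intro ballI impI)
  fix z assume z: "z \<in> Ker (complexify L)" "z \<noteq> 0"
  have "re_vec z \<noteq> 0 \<or> im_vec z \<noteq> 0"
    using z(2) by (auto simp: vec_eq_iff complex_eq_iff)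
  moreover have "(X *v x) \<bullet> x \<ge> 0" if "L *v x = 0" for x
    using assms[OF that] by (cases "x = 0") auto
  ultimately show "Re (cinner (complexify X *v z) z) > 0"
    unfolding Re_cinner_complexify
    using assms Ker_complexifyD[OF z(1)] by (meson add_nonneg_pos add_pos_nonneg)
qed

text \<open>A nonzero real kernel vector, read as a complex one, would make the form vanish.\<close>

lemma pos_on_complexify_UNIV_invertible:
  fixes X :: "real ^ 'm ^ 'm"
  assumes "pos_on (complexify X) UNIV"
  shows "invertible X"
proof -
  have "x = 0" if "X *v x = 0" for x
  proof (rule ccontr)
    let ?z = "(\<chi> i. complex_of_real (x $ i)) :: complex ^ 'm"
    assume "x \<noteq> 0"
    then have "?z \<noteq> 0" by (auto simp: vec_eq_iff)
    then have "Re (cinner (complexify X *v ?z) ?z) > 0"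
      using assms by (simp add: pos_on_def)
    moreover have "re_vec ?z = x" "im_vec ?z = 0" by (auto simp: vec_eq_iff)
    ultimately show False by (simp add: Re_cinner_complexify that)
  qed
  then show ?thesis
    by (metis invertible_left_inverse matrix_left_invertible_ker)
qed

subsection \<open>Absorption of the cross terms\<close>

text \<open>Applied with \<open>a j\<close> the norm of \<open>P j \<omega> *v x\<close>; the
  weights depend only on M and C, so they serve all \<omega> and x at once. After rescaling a to s,
  AM-GM bounds each cross term by neighbouring squares with the small factor
  \<open>d^2\<close>.\<close>

lemma weighted_squares_dominate:
  fixes M :: nat and C :: real
  assumes "C \<ge> 0"
  obtains e :: "nat \<Rightarrow> real" where "\<And>j. e j > 0"
    and "\<And>a. \<lbrakk>a 0 = 0; a (Suc M) ^ 2 \<le> C * (\<Sum>j<M. a (Suc j) ^ 2)\<rbrakk> \<Longrightarrow>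
      (\<Sum>j<M. e j * a (Suc j) ^ 2) / 2
        \<le> (\<Sum>j<M. e j * (a (Suc j) ^ 2 - a (Suc (Suc j)) * a j))"
proof
  \<comment> \<open>The two shifted sums of squares will total at most \<open>(C + 2) * T\<close>;
    this choice gives \<open>d^2 * (C + 2) = d\<close>, which is at most 1.\<close>
  define d where "d = 1 / (C + 2)"
  have d: "d > 0" "d \<le> 1" using assms by (auto simp: d_def)
  text \<open>The second difference of \<open>p\<close> is \<open>-2\<close>, and \<open>p\<close> increases up to \<open>M\<close> with
    \<open>p (M + 1) = p M\<close>.\<close>
  define p :: "nat \<Rightarrow> nat" where "p k = k * (2 * M + 1 - k)" for k
  define e where "e j = (d ^ p (Suc j)) ^ 2" for j
  show "e j > 0" for j using d by (simp add: e_def)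
  have pp: "p j + p (Suc (Suc j)) + 2 = 2 * p (Suc j)" if jM: "j < M" for j
  proof -
    \<comment> \<open>This form of M clears the truncated subtractions in p.\<close>
    obtain r where "M = Suc (j + r)" using less_imp_Suc_add[OF jM] by blast
    then have eqs: "2 * M + 1 - j = j + 2 * r + 3" "2 * M + 1 - Suc j = j + 2 * r + 2"
      "2 * M + 1 - Suc (Suc j) = j + 2 * r + 1" by simp_all
    show ?thesis unfolding p_def eqs by (simp add: algebra_simps)
  qed
  have pM: "p (Suc j) \<le> p (Suc M)" if jM: "j < M" for j
  proof -
    obtain r where r: "M = Suc (j + r)" using less_imp_Suc_add[OF jM] by blast
    have "2 * M + 1 - Suc j = j + 2 * r + 2" "2 * M + 1 - Suc M = M" using r by simp_all
    then have "p (Suc j) = Suc j * (j + 2 * r + 2)" "p (Suc M) = Suc M * M"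
      unfolding p_def by metis+
    then show ?thesis by (simp add: r algebra_simps)
  qed
  fix a :: "nat \<Rightarrow> real"
  assume a0: "a 0 = 0" and aM: "a (Suc M) ^ 2 \<le> C * (\<Sum>j<M. a (Suc j) ^ 2)"
  define s where "s k = d ^ p k * a k" for k
  define T where "T = (\<Sum>j<M. s (Suc j) ^ 2)"
  have T0: "T \<ge> 0" by (simp add: T_def sum_nonneg)
  have es: "e j * a (Suc j) ^ 2 = s (Suc j) ^ 2" for j
    by (simp add: e_def s_def power_mult_distrib)
  have cross: "e j * (a (Suc (Suc j)) * a j) \<le> d^2 / 2 * (s (Suc (Suc j)) ^ 2 + s j ^ 2)"
    if "j < M" for j
  proof -
    \<comment> \<open>The second difference of p splits the weight into those of the two factors,
      with \<open>d^2\<close> left over.\<close>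
    have "e j = d ^ (p j + p (Suc (Suc j)) + 2)"
      unfolding pp[OF that] e_def by (simp add: power_even_eq)
    then have "e j * (a (Suc (Suc j)) * a j) = d^2 * (s (Suc (Suc j)) * s j)"
      by (simp add: s_def power_add power2_eq_square mult_ac)
    also have "\<dots> \<le> d^2 * ((s (Suc (Suc j)) ^ 2 + s j ^ 2) / 2)"
      using sum_squares_bound[of "s (Suc (Suc j))" "s j"] by (intro mult_left_mono) auto
    finally show ?thesis by simp
  qed
  \<comment> \<open>By \<open>pM\<close> and d \<le> 1 the weight at \<open>Suc M\<close> is no
    larger than the earlier ones, so the bound on \<open>a (Suc M)\<close> passes to s with the same
    C.\<close>
  have sM: "s (Suc M) ^ 2 \<le> C * T"
  proof -
    have "s (Suc M) ^ 2 \<le> (d ^ p (Suc M)) ^ 2 * (C * (\<Sum>j<M. a (Suc j) ^ 2))"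
      unfolding s_def power_mult_distrib by (intro mult_left_mono aM) simp
    also have "\<dots> = C * (\<Sum>j<M. (d ^ p (Suc M)) ^ 2 * a (Suc j) ^ 2)"
      by (simp add: sum_distrib_left mult_ac)
    also have "\<dots> \<le> C * T"
      unfolding T_def s_def power_mult_distrib
      using d by (intro mult_left_mono sum_mono mult_right_mono power_mono power_decreasing pM
          assms) auto
    finally show ?thesis .
  qed
  have s0: "s 0 = 0" by (simp add: s_def a0)
  \<comment> \<open>Shifting up adds only the end term bounded by \<open>sM\<close>; shifting down
    adds only \<open>s 0 = 0\<close>.\<close>
  have up: "(\<Sum>j<M. s (Suc (Suc j)) ^ 2) \<le> T + C * T"
    using sum.lessThan_Suc_shift[of "\<lambda>j. s (Suc j) ^ 2" M] sM
    by (simp add: T_def) (smt (verit) zero_le_power2)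
  have down: "(\<Sum>j<M. s j ^ 2) \<le> T"
    using sum.lessThan_Suc_shift[of "\<lambda>j. s j ^ 2" M] s0
    by (simp add: T_def) (smt (verit) zero_le_power2)
  have "(\<Sum>j<M. e j * (a (Suc (Suc j)) * a j))
      \<le> d^2 / 2 * ((\<Sum>j<M. s (Suc (Suc j)) ^ 2) + (\<Sum>j<M. s j ^ 2))"
    unfolding sum.distrib[symmetric] sum_distrib_left by (intro sum_mono cross) simp
  also have "\<dots> \<le> d^2 / 2 * ((C + 2) * T)"
    using up down by (intro mult_left_mono) (auto simp: algebra_simps)
  also have "\<dots> = d / 2 * T"
    using assms by (simp add: d_def power2_eq_square)
  also have "\<dots> \<le> T / 2"
    using d T0 mult_right_mono[of d 1 T] by simp
  finally show "(\<Sum>j<M. e j * a (Suc j) ^ 2) / 2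
      \<le> (\<Sum>j<M. e j * (a (Suc j) ^ 2 - a (Suc (Suc j)) * a j))"
    by (simp add: right_diff_distrib sum_subtractf es T_def)
qed

subsection \<open>The rank condition\<close>

text \<open>Each block has an exponent below \<open>CARD('m)\<close>, so x is in the kernel of the
  stacked matrix; full column rank means injectivity.\<close>

lemma full_rank_stacked_matrix_kernel:
  fixes L X :: "real ^ 'm ^ 'm"
  assumes "rank (stacked_matrix L X) = CARD('m)"
    and "\<And>j. j < CARD('m) \<Longrightarrow> (L ** matrix_power X j) *v x = 0"
  shows "x = 0"
proof -
  have "stacked_matrix L X *v x = 0"
  proof -
    have "to_nat_on (UNIV :: 'm set) i < CARD('m)" for i
      using bij_betwE[OF to_nat_on_finite[of "UNIV :: 'm set"]] by auto
    then have "((L ** matrix_power X (to_nat_on (UNIV :: 'm set) i)) *v x) $ k = 0" for i k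
      using assms(2) by simp
    then show ?thesis
      by (simp add: stacked_matrix_def vec_eq_iff matrix_vector_mult_def)
  qed
  moreover have "inj ((*v) (stacked_matrix L X))"
    using assms(1) by (simp add: full_rank_injective)
  ultimately show ?thesis
    by (metis injD mv.zero_right)
qed

text \<open>The sum \<open>?D\<close> vanishes only for x = 0 when \<omega> is on the sphere, so the
  quotient is continuous, hence bounded, on the compact product of spheres. Homogeneity of degree 2
  in x extends the bound to all x.\<close>

lemma uniform_observability_bound:
  fixes P :: "nat \<Rightarrow> 'x::euclidean_space \<Rightarrow> real ^ 'b ^ 'a"
  assumes cont: "\<And>j. continuous_on UNIV (P j)"
    and ker: "\<And>\<omega> x. \<omega> \<in> sphere 0 1 \<Longrightarrow> (\<forall>j<N. P j \<omega> *v x = 0) \<Longrightarrow> x = 0"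
  obtains C where "C \<ge> 0"
    and "\<And>\<omega> x. \<omega> \<in> sphere 0 1 \<Longrightarrow>
      norm (P k \<omega> *v x) ^ 2 \<le> C * (\<Sum>j<N. norm (P j \<omega> *v x) ^ 2)"
proof -
  let ?S = "sphere 0 1 \<times> sphere 0 1 :: ('x \<times> (real ^ 'b)) set"
  let ?D = "\<lambda>\<omega> x. \<Sum>j<N. norm (P j \<omega> *v x) ^ 2"
  have D0: "?D \<omega> x \<noteq> 0" if "\<omega> \<in> sphere 0 1" "x \<noteq> 0" for \<omega> x
    using ker[OF that(1), of x] that(2) by (auto simp: sum_nonneg_eq_0_iff)
  have D1: "?D (fst p) (snd p) \<noteq> 0" if "p \<in> ?S" for p
    using that by (intro D0) auto
  have c: "continuous_on ?S (\<lambda>p. P j (fst p) *v snd p)" for j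
    by (intro mv.continuous_on continuous_on_compose2[OF cont] continuous_intros) auto
  have "continuous_on ?S (\<lambda>p. norm (P k (fst p) *v snd p) ^ 2 / ?D (fst p) (snd p))"
    using D1 by (intro continuous_intros c) blast
  then have "bounded ((\<lambda>p. norm (P k (fst p) *v snd p) ^ 2 / ?D (fst p) (snd p)) ` ?S)"
    by (intro compact_imp_bounded compact_continuous_image compact_Times) auto
  then obtain C where C0: "C > 0"
    and bd: "\<And>p. p \<in> ?S \<Longrightarrow> norm (norm (P k (fst p) *v snd p) ^ 2 / ?D (fst p) (snd p)) \<le> C"
    unfolding bounded_pos by blast
  have C: "norm (P k \<omega> *v x) ^ 2 / ?D \<omega> x \<le> C" if "\<omega> \<in> sphere 0 1" "x \<in> sphere 0 1" for \<omega> x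
    using bd[of "(\<omega>, x)"] that by (simp add: sum_nonneg)
  have "norm (P k \<omega> *v x) ^ 2 \<le> C * ?D \<omega> x" if \<omega>: "\<omega> \<in> sphere 0 1" for \<omega> x
  proof (cases "x = 0")
    case False
    define u where "u = x /\<^sub>R norm x"
    have u: "u \<in> sphere 0 1" using False by (simp add: u_def)
    have x: "x = norm x *\<^sub>R u" using False by (simp add: u_def)
    have "?D \<omega> u > 0"
      using D0[OF \<omega>, of u] u by (simp add: sum_nonneg less_le) (metis norm_zero zero_neq_one)
    then have "norm (P k \<omega> *v u) ^ 2 \<le> C * ?D \<omega> u"
      using C[OF \<omega> u] by (simp add: pos_divide_le_eq)
    then have "norm x ^ 2 * norm (P k \<omega> *v u) ^ 2 \<le> norm x ^ 2 * (C * ?D \<omega> u)"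
      by (intro mult_left_mono) auto
    moreover have "norm (P j \<omega> *v x) ^ 2 = norm x ^ 2 * norm (P j \<omega> *v u) ^ 2" for j
      by (subst x) (simp add: mv.scaleR_right power_mult_distrib)
    ultimately show ?thesis
      by (simp add: sum_distrib_left mult_ac)
  qed simp
  then show ?thesis using that C0 by (metis less_imp_le)
qed

subsection \<open>The compensating matrix\<close>

theorem theorem4p3:
  fixes A0 L :: "real ^ 'm ^ 'm" and A :: "'n::finite \<Rightarrow> real ^ 'm ^ 'm"
  assumes "condition_A A0 A L"
    and "condition_R A0 A L"
  shows "condition_K A0 A L"
proof -
  define M where "M = CARD('m)"
  define B where "B \<omega> = matrix_inv A0 ** symbol A \<omega>" for \<omega>
  define P where "P j \<omega> = L ** matrix_power (B \<omega>) j" for j \<omega>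
  have "invertible A0"
    using assms(1) by (auto simp: condition_A_def intro: pos_on_complexify_UNIV_invertible)
  then have inv: "matrix_inv A0 ** A0 = mat 1"
    unfolding invertible_def matrix_inv_def by (rule someI2_ex) simp
  have smooth_P: "higher_differentiable_on UNIV (P j) k" for j k
    unfolding P_def B_def
    by (intro higher_differentiable_on_matrix_mult higher_differentiable_on_matrix_power
        higher_differentiable_on_const higher_differentiable_on_symbol)
  have P_B: "P j \<omega> ** B \<omega> = P (Suc j) \<omega>" for j \<omega>
    by (simp add: P_def matrix_mul_assoc[symmetric] matrix_power_commute)
  have P_minus: "P j (- \<omega>) = (- 1) ^ j *\<^sub>R P j \<omega>" for j \<omega>
    by (simp add: P_def B_def symbol_minus mm.minus_right matrix_power_minus mm.scaleR_right)
  \<comment> \<open>The range ends at M so that, once the term with j = 0 drops out on the kernel of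
    L, the indices 1 to M match the squares in \<open>weighted_squares_dominate\<close>.\<close>
  have ker: "x = 0" if \<omega>: "\<omega> \<in> sphere 0 1" and x: "\<forall>j<Suc M. P j \<omega> *v x = 0" for \<omega> x
  proof (rule full_rank_stacked_matrix_kernel)
    show "rank (stacked_matrix L (B \<omega>)) = CARD('m)"
      using assms(2) \<omega> unfolding condition_R_def B_def by blast
    show "(L ** matrix_power (B \<omega>) j) *v x = 0" if "j < CARD('m)" for j
      using x that unfolding P_def M_def by (meson less_SucI)
  qed
  have cont: "continuous_on UNIV (P j)" for j
    using smooth_P[of j 0] by simp
  obtain C where "C \<ge> 0" and C: "\<And>\<omega> x. \<omega> \<in> sphere 0 1 \<Longrightarrow>
      norm (P (Suc M) \<omega> *v x) ^ 2 \<le> C * (\<Sum>j<Suc M. norm (P j \<omega> *v x) ^ 2)"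
    by (rule uniform_observability_bound[where P = P and N = "Suc M" and k = "Suc M", OF cont])
      (use ker in blast)+
  \<comment> \<open>Since C is uniform, e is constant in \<omega>, which keeps \<open>S\<close>
    polynomial and odd.\<close>
  obtain e where e: "\<And>j. e j > 0"
    and dom: "\<And>a. \<lbrakk>a 0 = 0; a (Suc M) ^ 2 \<le> C * (\<Sum>j<M. a (Suc j) ^ 2)\<rbrakk> \<Longrightarrow>
      (\<Sum>j<M. e j * a (Suc j) ^ 2) / 2
        \<le> (\<Sum>j<M. e j * (a (Suc j) ^ 2 - a (Suc (Suc j)) * a j))"
    by (rule weighted_squares_dominate[OF \<open>C \<ge> 0\<close>]) (rule that)
  define Q where "Q j \<omega> = transpose (P (Suc j) \<omega>) ** P j \<omega>" for j \<omega>
  define S where "S \<omega> = (\<Sum>j<M. e j *\<^sub>R (Q j \<omega> - transpose (Q j \<omega>)))" for \<omega>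
  define K where "K \<omega> = S \<omega> ** matrix_inv A0" for \<omega>
  have "higher_differentiable_on UNIV K k" for k
    unfolding K_def S_def Q_def
    by (intro higher_differentiable_on_matrix_mult higher_differentiable_on_const
        higher_differentiable_on_sum smooth_P
        higher_differentiable_on_linear_compose[OF bounded_linear_scaleR_right]
        higher_differentiable_on_linear_compose
          [OF bounded_linear_sub[OF bounded_linear_ident bounded_linear_transpose]]
        higher_differentiable_on_linear_compose[OF bounded_linear_transpose])
  \<comment> \<open>The formula for K makes sense on the whole space, so K is its own smooth
    extension.\<close>
  then have smooth: "smooth_on_unit_sphere K"
    unfolding smooth_on_unit_sphere_def by (intro exI[of _ UNIV] exI[of _ K] conjI allI) auto
  \<comment> \<open>The factors have consecutive degrees, so their signs multiply to -1.\<close>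
  have "Q j (- \<omega>) = - Q j \<omega>" for j \<omega>
    by (simp add: Q_def P_minus transpose_linear mm.scaleR_left mm.scaleR_right
        mm.minus_left mm.minus_right flip: power_mult_distrib)
  then have "S (- \<omega>) = - S \<omega>" for \<omega>
    by (simp add: S_def transpose_linear flip: sum_negf scaleR_minus_right)
  then have odd: "K (- \<omega>) = - K \<omega>" for \<omega>
    by (simp add: K_def mm.minus_left)
  have K_A0: "K \<omega> ** A0 = S \<omega>" for \<omega>
    by (simp add: K_def matrix_mul_assoc[symmetric] inv)
  have skew: "transpose (S \<omega>) = - S \<omega>" for \<omega>
    by (simp add: S_def transpose_linear flip: sum_negf scaleR_minus_right)
  have pos: "(sym_part (K \<omega> ** symbol A \<omega>) *v x) \<bullet> x > 0"
    if \<omega>: "\<omega> \<in> sphere 0 1" and x: "L *v x = 0" "x \<noteq> 0" for \<omega> x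
  proof -
    define a where "a j = norm (P j \<omega> *v x)" for j
    have a0: "a 0 = 0" by (simp add: a_def P_def x)
    have "a (Suc M) ^ 2 \<le> C * (\<Sum>j<M. a (Suc j) ^ 2)"
      using C[OF \<omega>, of x] a0 by (simp add: a_def sum.lessThan_Suc_shift del: sum.lessThan_Suc)
    note dom_a = dom[OF a0 this]
    \<comment> \<open>This index is not 0 because L x = 0, so one of the weighted squares is
      positive.\<close>
    obtain j where j: "j < Suc M" "P j \<omega> *v x \<noteq> 0"
      using ker[OF \<omega>, of x] x by auto
    then obtain i where "i < M" "a (Suc i) > 0"
      using a0 by (cases j) (auto simp: a_def)
    then have "0 < (\<Sum>j<M. e j * a (Suc j) ^ 2)"
      using e by (intro sum_pos2[of _ i]) (auto intro!: mult_nonneg_nonneg less_imp_le[OF e])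
    also have "\<dots> / 2 \<le> (\<Sum>j<M. e j * (a (Suc j) ^ 2 - a (Suc (Suc j)) * a j))"
      by (rule dom_a)
    also have "\<dots> \<le> (\<Sum>j<M. e j * (a (Suc j) ^ 2 - (P (Suc (Suc j)) \<omega> *v x) \<bullet> (P j \<omega> *v x)))"
      using e by (intro sum_mono mult_left_mono diff_left_mono)
        (auto simp: a_def norm_cauchy_schwarz intro: less_imp_le)
    \<comment> \<open>The factor B raises the right-hand index by one: \<open>Q j\<close> yields the
      square, its transpose the cross term.\<close>
    also have "\<dots> = (S \<omega> *v (B \<omega> *v x)) \<bullet> x"
    proof -
      have "((transpose (P i \<omega>) ** P j \<omega>) *v (B \<omega> *v x)) \<bullet> x
          = (P (Suc j) \<omega> *v x) \<bullet> (P i \<omega> *v x)" for i j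
        by (subst inner_transpose_mult) (simp add: matrix_vector_mul_assoc P_B)
      then show ?thesis
        by (simp add: S_def Q_def matrix_transpose_mul mv.sum_left mv.scaleR_left mv.diff_left
            inner_sum_left inner_diff_left a_def power2_norm_eq_inner)
    qed
    also have "S \<omega> *v (B \<omega> *v x) = (K \<omega> ** symbol A \<omega>) *v x"
      by (simp add: K_def B_def matrix_vector_mul_assoc matrix_mul_assoc)
    finally show ?thesis by (simp add: inner_sym_part)
  qed
  show ?thesis
    unfolding condition_K_def
    by (intro exI[of _ K] conjI ballI smooth odd pos_on_complexify_KerI pos)
      (auto simp: K_A0 skew)
qed

end
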